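(* Let $\alpha\in(0,1)$ and suppose $(X,C^* )$ is $f(\alpha)$-clusterable. Then for any set of centroids $C$ such that $\Delta(C,C^* )\le b\,\phi^*$ for some $b\le\frac{f(\alpha)^2}{16^2}$, we have $$\max_{r\in[k]}\frac{|A_r\triangle A_r^*|}{n_r^*}\le\frac{b}{f(\alpha)^3},$$ where $A$ is the clustering induced by $C$, with clusters indexed according to the permutation attaining $\Delta(C,C^* )$, and $A^*$ is the clustering induced by $C^*$. That is, $C^*$ is $\big(\frac{f(\alpha)^2}{16^2},\alpha\big)$-stable.
   Context: **$k$-means.** $X\subset\mathbb{R}^d$ is a finite dataset. For $C=\{c_1,\dots,c_k\}\subset\mathbb{R}^d$, $\phi(C)=\sum_{x\in X}\min_r\|x-c_r\|^2$. $V(C)\cap X$ is the set of all clusterings $A=\{A_r\}$ of $X$ obtained by assigning each point to one of its closest centroids; if unique it is denoted $v(C)$. $m(A)$ is the set of cluster means. $C^*$ is a stationary point if $C^*=m(A^* )$ for a clustering $A^*\in V(C^* )\cap X$. Write $n_r^*=|A_r^*|$ and $\phi^*=\phi(C^* )>0$. **Margin.** For $A\in V(C)\cap X$, $r\neq s$, $x\in A_r\cup A_s$, let $\bar x$ be the projection of $x$ onto the line through $c_r,c_s$, and $\Delta_{rs}(C)=\min_{x\in A_r\cup A_s}\big|\|\bar x-c_r\|-\|\bar x-c_s\|\big|$. $C$ has a $\delta$-margin if for some $A\in V(C)\cap X$, $\min_{r,\,s\ne r}\Delta_{rs}(C)=\delta$. **$f(\alpha)$-clusterability.** $(X,C^*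 )$ is $f(\alpha)$-clusterable if $C^*$ is a stationary point having a $\delta$-margin with, for all $r\ne s$, $\delta\ge f(\alpha)\sqrt{\phi^*}\big(\frac1{\sqrt{n_r^*}}+\frac1{\sqrt{n_s^*}}\big)$, where $f(\alpha)>\max\{64^2,\frac{5\alpha+5}{256\alpha},\max_{r\neq s}\frac{n_r^*}{n_s^*}\}$. **Distances.** $\Delta(C,C^* )=\min_\pi\sum_r n_r^*\|c_{\pi(r)}-c_r^*\|^2$ over permutations $\pi$ of $[k]$; $\mathrm{ClustDist}(v(C),v(C^* ))=\max_r\frac{|A_{\pi(r)}\triangle A_r^*|}{n_r^*}$ with $A=v(C)$ and $\pi$ attaining $\Delta(C,C^* )$. **Stability.** For $b_0>0$, $\alpha\in[0,1)$, a stationary point $C^*$ is $(b_0,\alpha)$-stable if for every $b'\le b_0$ and every $C$ with $\Delta(C,C^* )\le b'\phi^*$, there is $b\le\alpha b'$ ($b\ge 0$) with $\mathrm{ClustDist}(v(C),v(C^* ))\le\frac{b}{5b+4(1+\phi(C)/\phi^* )}$. *)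

theory Defs
  imports "HOL-Analysis.Analysis"
begin

text \<open>
  A set of \<open>k\<close> centroids is an indexed family \<open>c :: 'k \<Rightarrow> 'a\<close> over a finite index type with \<open>k\<close>
  elements, and a clustering is a family \<open>A :: 'k \<Rightarrow> 'a set\<close> over the same indices. Centroids need
  not be distinct and clusters may be empty, unless stated otherwise.
\<close>

definition kmeans_cost :: "'a::euclidean_space set \<Rightarrow> ('k::finite \<Rightarrow> 'a) \<Rightarrow> real" where
  "kmeans_cost X c = (\<Sum>x\<in>X. MIN r. (norm (x - c r))\<^sup>2)"

text \<open>
  The set \<open>V(C) \<inter> X\<close>: \<open>a\<close> sends each data point to the index of one of its closest
  centroids, with ties broken arbitrarily.
\<close>

definition clusterings :: "'a::euclidean_space set \<Rightarrow> ('k::finite \<Rightarrow> 'a) \<Rightarrow> ('k \<Rightarrow> 'a set) set" where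
  "clusterings X c = {A. \<exists>a. (\<forall>x\<in>X. \<forall>s. norm (x - c (a x)) \<le> norm (x - c s)) \<and>
                             (\<forall>r. A r = {x\<in>X. a x = r})}"

definition cluster_mean :: "'a::euclidean_space set \<Rightarrow> 'a" where
  "cluster_mean S = (\<Sum>x\<in>S. x) /\<^sub>R real (card S)"

definition cluster_means :: "('k::finite \<Rightarrow> 'a::euclidean_space set) \<Rightarrow> 'a set" where
  "cluster_means A = range (\<lambda>r. cluster_mean (A r))"

text \<open>
  \<open>cs\<close> is a stationary point, witnessed by its clustering \<open>As\<close>. The mean of an empty cluster is
  undefined, so the clusters are nonempty. The equation \<open>C\<^sup>* = m(A\<^sup>*)\<close> is one between sets.
  The witness is kept as a parameter because the cluster sizes \<open>card (As r)\<close> enter the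
  notions below.
\<close>

definition stationary_point ::
    "'a::euclidean_space set \<Rightarrow> ('k::finite \<Rightarrow> 'a) \<Rightarrow> ('k \<Rightarrow> 'a set) \<Rightarrow> bool" where
  "stationary_point X cs As \<longleftrightarrow>
     As \<in> clusterings X cs \<and> (\<forall>r. As r \<noteq> {}) \<and> range cs = cluster_means As"

definition line_projection :: "'a::euclidean_space \<Rightarrow> 'a \<Rightarrow> 'a \<Rightarrow> 'a" where
  "line_projection p q x = closest_point (affine hull {p, q}) x"

text \<open>
  Margins are extended reals, so that the minimum over an empty set is \<open>\<infinity>\<close>; this concerns
  \<open>\<Delta>\<^sub>r\<^sub>s\<close> for two empty clusters, and the margin itself when \<open>k = 1\<close>. For finite data the
  infima over nonempty sets are minima.
\<close>

definition pair_margin ::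
    "('k::finite \<Rightarrow> 'a::euclidean_space) \<Rightarrow> ('k \<Rightarrow> 'a set) \<Rightarrow> 'k \<Rightarrow> 'k \<Rightarrow> ereal" where
  "pair_margin c A r s =
     (INF x \<in> A r \<union> A s. ereal \<bar>norm (line_projection (c r) (c s) x - c r) -
                                 norm (line_projection (c r) (c s) x - c s)\<bar>)"

definition has_margin ::
    "'a::euclidean_space set \<Rightarrow> ('k::finite \<Rightarrow> 'a) \<Rightarrow> ereal \<Rightarrow> bool" where
  "has_margin X c \<delta> \<longleftrightarrow>
     (\<exists>A \<in> clusterings X c. (INF (r, s) \<in> {(r, s). r \<noteq> s}. pair_margin c A r s) = \<delta>)"

text \<open>Here \<open>f\<close> is the number written \<open>f(\<alpha>)\<close>.\<close>

definition clusterable ::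
    "'a::euclidean_space set \<Rightarrow> ('k::finite \<Rightarrow> 'a) \<Rightarrow> ('k \<Rightarrow> 'a set) \<Rightarrow> real \<Rightarrow> real \<Rightarrow> bool" where
  "clusterable X cs As f \<alpha> \<longleftrightarrow>
     stationary_point X cs As \<and>
     f > Max ({64\<^sup>2, (5 * \<alpha> + 5) / (256 * \<alpha>)} \<union>
              {real (card (As r)) / real (card (As s)) | r s. r \<noteq> s}) \<and>
     (\<exists>\<delta>. has_margin X cs \<delta> \<and>
        (\<forall>r s. r \<noteq> s \<longrightarrow>
           ereal (f * sqrt (kmeans_cost X cs) *
                    (1 / sqrt (real (card (As r))) + 1 / sqrt (real (card (As s))))) \<le> \<delta>))"

definition matching_cost ::
    "('k::finite \<Rightarrow> 'a set) \<Rightarrow> ('k \<Rightarrow> 'a::euclidean_space) \<Rightarrow> ('k \<Rightarrow> 'a) \<Rightarrow> ('k \<Rightarrow> 'k) \<Rightarrow> real" where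
  "matching_cost As c cs \<pi> = (\<Sum>r\<in>UNIV. real (card (As r)) * (norm (c (\<pi> r) - cs r))\<^sup>2)"

definition centroid_dist ::
    "('k::finite \<Rightarrow> 'a set) \<Rightarrow> ('k \<Rightarrow> 'a::euclidean_space) \<Rightarrow> ('k \<Rightarrow> 'a) \<Rightarrow> real" where
  "centroid_dist As c cs = (MIN \<pi> \<in> {\<pi>. \<pi> permutes UNIV}. matching_cost As c cs \<pi>)"

definition optimal_matching ::
    "('k::finite \<Rightarrow> 'a set) \<Rightarrow> ('k \<Rightarrow> 'a::euclidean_space) \<Rightarrow> ('k \<Rightarrow> 'a) \<Rightarrow> ('k \<Rightarrow> 'k) \<Rightarrow> bool" where
  "optimal_matching As c cs \<pi> \<longleftrightarrow>
     \<pi> permutes UNIV \<and> matching_cost As c cs \<pi> = centroid_dist As c cs"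

definition clust_dist ::
    "('k::finite \<Rightarrow> 'k) \<Rightarrow> ('k \<Rightarrow> 'a set) \<Rightarrow> ('k \<Rightarrow> 'a set) \<Rightarrow> real" where
  "clust_dist \<pi> A As =
     (MAX r. real (card (sym_diff (A (\<pi> r)) (As r))) / real (card (As r)))"

text \<open>
  The clustering induced by \<open>c\<close>, and the permutation attaining the minimal matching cost, need not
  be unique; the bound is required for every choice of them.
\<close>

definition is_stable ::
    "'a::euclidean_space set \<Rightarrow> ('k::finite \<Rightarrow> 'a) \<Rightarrow> ('k \<Rightarrow> 'a set) \<Rightarrow> real \<Rightarrow> real \<Rightarrow> bool" where
  "is_stable X cs As b\<^sub>0 \<alpha> \<longleftrightarrow>
     b\<^sub>0 > 0 \<and> 0 \<le> \<alpha> \<and> \<alpha> < 1 \<and> stationary_point X cs As \<and>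
     (\<forall>b' \<le> b\<^sub>0. \<forall>c. centroid_dist As c cs \<le> b' * kmeans_cost X cs \<longrightarrow>
        (\<exists>b. 0 \<le> b \<and> b \<le> \<alpha> * b' \<and>
           (\<forall>A \<in> clusterings X c. \<forall>\<pi>. optimal_matching As c cs \<pi> \<longrightarrow>
              clust_dist \<pi> A As \<le>
                b / (5 * b + 4 * (1 + kmeans_cost X c / kmeans_cost X cs)))))"

end

theory Submission
  imports Defs
begin

text \<open>
  A data point \<open>x\<close> of \<open>A\<^sup>*\<^sub>t\<close> lies at least \<open>\<delta>/2\<close> off the bisector of \<open>c\<^sup>*\<^sub>t\<close> and every other
  centroid \<open>c\<^sup>*\<^sub>u\<close>. If \<open>C\<close> nevertheless assigns \<open>x\<close> to \<open>c\<^sub>u\<close>, the small displacements of \<open>c\<^sub>t\<close> and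
  \<open>c\<^sub>u\<close> can only have moved the bisector across \<open>x\<close> by rotating it, which forces \<open>x\<close> to be far
  from \<open>c\<^sup>*\<^sub>t\<close>: \<open>b \<parallel>x - c\<^sup>*\<^sub>t\<parallel>\<^sup>2 \<ge> (9/64) f\<^sup>4 \<phi>\<^sup>* / n\<^sup>*\<^sub>r\<close> for both \<open>r = t\<close> and \<open>r = u\<close>. Since these squared
  distances sum to at most \<open>\<phi>\<^sup>*\<close>, there are few such points.
\<close>

section \<open>Projections and displaced bisectors\<close>

text \<open>A closest point of a convex set gives only an obtuse angle, hence an inequality. In an
  affine set the inequality also holds for the reflection of \<open>y\<close> through the
  projection, and the two together force orthogonality.\<close>

lemma line_projection_pythagoras:
  fixes p q x :: "'a::euclidean_space"
  assumes "y \<in> affine hull {p, q}"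
  shows "(norm (x - y))\<^sup>2
       = (norm (x - line_projection p q x))\<^sup>2 + (norm (line_projection p q x - y))\<^sup>2"
proof -
  define S where "S = affine hull {p, q}"
  define z where "z = closest_point S x"
  have S: "convex S" "closed S" "y \<in> S" "affine S"
    using assms by (auto simp: S_def affine_imp_convex)
  have z: "z \<in> S"
    unfolding z_def using S by (intro closest_point_in_set) auto
  have "2 *\<^sub>R z - y = (2::real) *\<^sub>R z + (-1::real) *\<^sub>R y"
    by simp
  also have "\<dots> \<in> S"
    using S z by (intro mem_affine) auto
  finally have w: "2 *\<^sub>R z - y \<in> S" .
  have "(x - z) \<bullet> (y - z) \<le> 0"
    unfolding z_def using S by (intro closest_point_dot) auto
  moreover have "(x - z) \<bullet> ((2 *\<^sub>R z - y) - z) \<le> 0"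
    using closest_point_dot[OF S(1,2) w, of x] unfolding z_def .
  ultimately have "(x - z) \<bullet> (z - y) = 0"
    by (simp add: algebra_simps inner_diff_right)
  then have "(norm ((x - z) + (z - y)))\<^sup>2 = (norm (x - z))\<^sup>2 + (norm (z - y))\<^sup>2"
    by (intro norm_add_Pythagorean) (simp add: orthogonal_def)
  then show ?thesis
    by (simp add: line_projection_def z_def S_def)
qed

text \<open>Pythagoras makes the difference of squared distances the same for \<open>x\<close> as
  for its projection. There it factors into a difference, at least \<open>d\<close>, and a sum, at
  least \<open>norm (p - q)\<close>. The closeness of \<open>x\<close> to \<open>p\<close> fixes the
  sign inside the absolute value.\<close>

lemma line_projection_gap:
  fixes p q x :: "'a::euclidean_space"
  assumes "0 \<le> d"
    and "d \<le> \<bar>norm (line_projection p q x - p) - norm (line_projection p q x - q)\<bar>"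
    and "norm (x - p) \<le> norm (x - q)"
  shows "d \<le> norm (p - q)"
    and "d * norm (p - q) \<le> (norm (x - q))\<^sup>2 - (norm (x - p))\<^sup>2"
proof -
  define z where "z = line_projection p q x"
  have p: "(norm (x - p))\<^sup>2 = (norm (x - z))\<^sup>2 + (norm (z - p))\<^sup>2"
    and q: "(norm (x - q))\<^sup>2 = (norm (x - z))\<^sup>2 + (norm (z - q))\<^sup>2"
    unfolding z_def by (intro line_projection_pythagoras hull_inc; simp)+
  have "(norm (x - p))\<^sup>2 \<le> (norm (x - q))\<^sup>2"
    using assms(3) by (intro power_mono) auto
  then have "(norm (z - p))\<^sup>2 \<le> (norm (z - q))\<^sup>2"
    using p q by linarith
  then have "norm (z - p) \<le> norm (z - q)"
    by (rule power2_le_imp_le) simp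
  then have d: "d \<le> norm (z - q) - norm (z - p)"
    using assms(2) by (simp add: z_def)
  have "norm (z - q) \<le> norm (z - p) + norm (p - q)"
    using norm_triangle_ineq[of "z - p" "p - q"] by simp
  then show "d \<le> norm (p - q)"
    using d by linarith
  have sum: "norm (p - q) \<le> norm (z - q) + norm (z - p)"
    using norm_triangle_ineq4[of "z - q" "z - p"] by simp
  have "d * norm (p - q) \<le> (norm (z - q) - norm (z - p)) * (norm (z - q) + norm (z - p))"
    using d sum assms(1) by (intro mult_mono) auto
  also have "\<dots> = (norm (x - q))\<^sup>2 - (norm (x - p))\<^sup>2"
    using p q by (simp add: power2_eq_square algebra_simps)
  finally show "d * norm (p - q) \<le> (norm (x - q))\<^sup>2 - (norm (x - p))\<^sup>2" .
qed

text \<open>With the origin moved to \<open>p\<close>, expanding the squares turns the misassignment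
  and the gap into a bound on \<open>d * norm (p - q)\<close>. Its only term involving
  \<open>x\<close> is the inner product of \<open>x - p\<close> with the relative displacement of
  the centroids; the other terms are small, so this one must be large.\<close>

lemma misassigned_point_far:
  fixes x p q p' q' :: "'a::real_inner"
  assumes "0 \<le> d" and "d \<le> norm (p - q)"
    and gap: "d * norm (p - q) \<le> (norm (x - q))\<^sup>2 - (norm (x - p))\<^sup>2"
    and mis: "norm (x - q') \<le> norm (x - p')"
    and small: "norm (p' - p) + norm (q' - q) \<le> d / 16"
  shows "3 / 4 * d\<^sup>2 \<le> 2 * norm (x - p) * (norm (p' - p) + norm (q' - q))"
proof -
  define a e y v where "a = p' - p" and "e = q' - q" and "y = x - p" and "v = q - p"
  have D: "norm (p - q) = norm v"
    by (simp add: v_def norm_minus_commute)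
  have le: "norm a \<le> d / 16" "norm e \<le> d / 16"
    using small norm_ge_zero[of a] norm_ge_zero[of e] unfolding a_def e_def by linarith+
  have "norm (y - v - e) \<le> norm (y - a)"
    using mis by (simp add: a_def e_def y_def v_def)
  then have "(norm (y - v - e))\<^sup>2 \<le> (norm (y - a))\<^sup>2"
    by (rule power_mono) simp
  moreover have "d * norm v \<le> (norm (y - v))\<^sup>2 - (norm y)\<^sup>2"
    using gap unfolding D by (simp add: y_def v_def)
  ultimately have "d * norm v \<le> 2 * (y \<bullet> (e - a)) - 2 * (v \<bullet> e) + (norm a)\<^sup>2 - (norm e)\<^sup>2"
    by (simp add: power2_norm_eq_inner inner_diff_left inner_diff_right inner_commute)
  moreover have "y \<bullet> (e - a) \<le> norm y * (norm a + norm e)"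
  proof -
    have "y \<bullet> (e - a) \<le> norm y * norm (e - a)"
      by (rule norm_cauchy_schwarz)
    also have "\<dots> \<le> norm y * (norm a + norm e)"
      using norm_triangle_ineq4[of e a] by (intro mult_left_mono) auto
    finally show ?thesis .
  qed
  moreover have "- (v \<bullet> e) \<le> norm v * norm e"
    using norm_cauchy_schwarz[of "- v" e] by simp
  moreover have "norm v * norm e \<le> norm v * (d / 16)"
    using le by (intro mult_left_mono) auto
  moreover have "(norm a)\<^sup>2 \<le> (d / 16)\<^sup>2"
    using le by (intro power_mono) auto
  then have "(norm a)\<^sup>2 \<le> d\<^sup>2 / 256"
    by (simp add: power_divide)
  moreover have "d\<^sup>2 \<le> d * norm v"
    using assms(1,2) D by (simp add: power2_eq_square mult_left_mono)
  moreover have "0 \<le> (norm e)\<^sup>2" "0 \<le> d\<^sup>2" "norm v * (d / 16) = d * norm v / 16"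
    by auto
  \<comment> \<open>The term in \<open>v \<bullet> e\<close> costs 1/8 of \<open>d * norm v\<close>,
    and the square of \<open>norm a\<close> costs 1/256 of the square of \<open>d\<close>; 1 - 1/8 -
    1/256 exceeds 3/4.\<close>
  ultimately have "3 / 4 * d\<^sup>2 \<le> 2 * (norm y * (norm a + norm e))"
    by linarith
  then show ?thesis
    by (simp add: a_def e_def y_def mult.assoc)
qed

section \<open>Clusterings and their costs\<close>

lemma clusterings_closest:
  assumes "A \<in> clusterings X c" and "x \<in> A r"
  shows "x \<in> X" and "norm (x - c r) \<le> norm (x - c s)"
  using assms by (auto simp: clusterings_def)

lemma clusterings_owner:
  assumes "A \<in> clusterings X c" and "x \<in> X"
  obtains r where "\<And>s. x \<in> A s \<longleftrightarrow> s = r"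
proof -
  obtain a where "\<And>r. A r = {x \<in> X. a x = r}"
    using assms(1) by (auto simp: clusterings_def)
  then show ?thesis
    using assms(2) that[of "a x"] by auto
qed

lemma clusterings_sum:
  fixes c :: "'k::finite \<Rightarrow> 'a::euclidean_space"
  assumes "finite X" and A: "A \<in> clusterings X c"
  shows "(\<Sum>x\<in>X. g x) = (\<Sum>r\<in>UNIV. \<Sum>x\<in>A r. (g x :: real))"
proof -
  have "X = (\<Union>r. A r)"
    using A by (auto simp: clusterings_def)
  moreover have "finite (A r)" for r
    using A assms(1) by (auto simp: clusterings_def)
  moreover have "A r \<inter> A s = {}" if "r \<noteq> s" for r s
    using A that by (auto simp: clusterings_def)
  ultimately show ?thesis
    by (simp add: sum.UNION_disjoint)
qed

lemma kmeans_point_cost: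
  fixes c :: "'k::finite \<Rightarrow> 'a::euclidean_space"
  assumes "A \<in> clusterings X c" and "x \<in> A r"
  shows "(MIN s. (norm (x - c s))\<^sup>2) = (norm (x - c r))\<^sup>2"
  using clusterings_closest(2)[OF assms]
  by (intro Min_eqI) (auto intro: power_mono)

lemma kmeans_cost_clusterings:
  fixes c :: "'k::finite \<Rightarrow> 'a::euclidean_space"
  assumes "finite X" and "A \<in> clusterings X c"
  shows "kmeans_cost X c = (\<Sum>r\<in>UNIV. \<Sum>x\<in>A r. (norm (x - c r))\<^sup>2)"
  unfolding kmeans_cost_def clusterings_sum[OF assms]
  using kmeans_point_cost[OF assms(2)] by (intro sum.cong) auto

text \<open>The parallel axis identity: the cross term vanishes because the deviations from the mean
  sum to zero.\<close>

lemma sum_norm_diff_mean: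
  fixes S :: "'a::euclidean_space set"
  assumes "finite S" and "S \<noteq> {}"
  shows "(\<Sum>x\<in>S. (norm (x - y))\<^sup>2)
       = (\<Sum>x\<in>S. (norm (x - cluster_mean S))\<^sup>2) + card S * (norm (y - cluster_mean S))\<^sup>2"
proof -
  define m where "m = cluster_mean S"
  have "real (card S) \<noteq> 0"
    using assms by simp
  then have "(\<Sum>x\<in>S. x - m) = 0"
    by (simp add: m_def cluster_mean_def sum_subtractf sum_constant_scaleR)
  then have 0: "(\<Sum>x\<in>S. (x - m) \<bullet> (y - m)) = 0"
    by (simp flip: inner_sum_left)
  have "(norm (x - y))\<^sup>2 = (norm (x - m))\<^sup>2 + (norm (y - m))\<^sup>2 - 2 * ((x - m) \<bullet> (y - m))" for x
    by (simp add: power2_norm_eq_inner inner_diff_left inner_diff_right inner_commute)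
  then have "(\<Sum>x\<in>S. (norm (x - y))\<^sup>2)
      = (\<Sum>x\<in>S. (norm (x - m))\<^sup>2) + card S * (norm (y - m))\<^sup>2 - 2 * (\<Sum>x\<in>S. (x - m) \<bullet> (y - m))"
    by (simp add: sum.distrib sum_subtractf sum_distrib_left)
  then show ?thesis
    unfolding 0 by (simp add: m_def)
qed

text \<open>Stationarity equates only sets, so the mean of \<open>As r\<close> could be another
  centroid \<open>cs s\<close>. The points of \<open>As r\<close> are no farther from
  \<open>cs r\<close> than from \<open>cs s\<close>, while the mean is the unique minimizer of the
  sum of squared distances; hence \<open>cs r\<close> is that mean.\<close>

lemma stationary_point_mean:
  fixes cs :: "'k::finite \<Rightarrow> 'a::euclidean_space"
  assumes "finite X" and st: "stationary_point X cs As"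
  shows "cs r = cluster_mean (As r)"
proof -
  define m where "m = cluster_mean (As r)"
  have As: "As \<in> clusterings X cs" "As r \<noteq> {}"
    and "range cs = cluster_means As"
    using st by (auto simp: stationary_point_def)
  then have "m \<in> range cs"
    by (auto simp: cluster_means_def m_def)
  then obtain s where s: "m = cs s" ..
  have fin: "finite (As r)"
    using clusterings_closest(1)[OF As(1)] assms(1) by (meson finite_subset subsetI)
  have "(\<Sum>x\<in>As r. (norm (x - cs r))\<^sup>2) \<le> (\<Sum>x\<in>As r. (norm (x - m))\<^sup>2)"
    unfolding s using clusterings_closest(2)[OF As(1)] by (intro sum_mono power_mono) auto
  then have "card (As r) * (norm (cs r - m))\<^sup>2 \<le> 0"
    unfolding sum_norm_diff_mean[OF fin As(2), of "cs r"] m_def by simp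
  moreover have "card (As r) > 0"
    using fin As(2) by (simp add: card_gt_0_iff)
  ultimately show ?thesis
    by (simp add: mult_le_0_iff m_def)
qed

text \<open>Sending all of \<open>As r\<close> to \<open>c (\<pi> r)\<close> costs at least as much
  as sending each point to its nearest centroid, and the parallel axis identity evaluates that
  cost.\<close>

lemma kmeans_cost_matching:
  fixes c cs :: "'k::finite \<Rightarrow> 'a::euclidean_space"
  assumes "finite X" and st: "stationary_point X cs As"
  shows "kmeans_cost X c \<le> kmeans_cost X cs + matching_cost As c cs \<pi>"
proof -
  have As: "As \<in> clusterings X cs" and ne: "\<And>r. As r \<noteq> {}"
    using st by (auto simp: stationary_point_def)
  have fin: "finite (As r)" for r
    using clusterings_closest(1)[OF As(1)] assms(1) by (meson finite_subset subsetI)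
  have "kmeans_cost X c = (\<Sum>r\<in>UNIV. \<Sum>x\<in>As r. MIN s. (norm (x - c s))\<^sup>2)"
    unfolding kmeans_cost_def by (rule clusterings_sum[OF assms(1) As])
  also have "\<dots> \<le> (\<Sum>r\<in>UNIV. \<Sum>x\<in>As r. (norm (x - c (\<pi> r)))\<^sup>2)"
    by (intro sum_mono Min_le) auto
  also have "\<dots> = kmeans_cost X cs + matching_cost As c cs \<pi>"
    unfolding kmeans_cost_clusterings[OF assms(1) As] matching_cost_def sum.distrib[symmetric]
      stationary_point_mean[OF assms]
    by (intro sum.cong refl sum_norm_diff_mean fin ne)
  finally show ?thesis .
qed

section \<open>Clusterable data\<close>

text \<open>
  The clustering witnessing the margin need not be \<open>As\<close> a priori. A positive margin excludes ties
  between centroids, so the two coincide.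
\<close>
lemma clusterable_gap:
  fixes X :: "'a::euclidean_space set" and cs :: "'k::finite \<Rightarrow> 'a" and As :: "'k \<Rightarrow> 'a set"
  defines "\<phi> \<equiv> kmeans_cost X cs"
  defines "w \<equiv> \<lambda>r s. sqrt \<phi> * (1 / sqrt (real (card (As r))) + 1 / sqrt (real (card (As s))))"
  assumes "finite X" and "\<phi> > 0" and "f > 0"
    and cl: "clusterable X cs As f \<alpha>" and x: "x \<in> As r" and "r \<noteq> s"
  shows "f * w r s \<le> norm (cs r - cs s)"
    and "f * w r s * norm (cs r - cs s) \<le> (norm (x - cs s))\<^sup>2 - (norm (x - cs r))\<^sup>2"
proof -
  have As: "As \<in> clusterings X cs" and ne: "\<And>r. As r \<noteq> {}"
    using cl by (auto simp: clusterable_def stationary_point_def)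
  have "finite (As r)" for r
    using clusterings_closest(1)[OF As(1)] assms(3) by (meson finite_subset subsetI)
  then have "card (As r) > 0" for r
    using ne by (simp add: card_gt_0_iff)
  then have w: "f * w r s > 0" for r s
    using assms(4,5) by (auto simp: w_def intro!: mult_pos_pos add_pos_pos)
  obtain \<delta> where "has_margin X cs \<delta>"
    and le: "\<And>r s. r \<noteq> s \<Longrightarrow> ereal (f * w r s) \<le> \<delta>"
    using cl unfolding clusterable_def w_def \<phi>_def mult.assoc by blast
  then obtain A where A: "A \<in> clusterings X cs"
    and "\<delta> = (INF (r, s) \<in> {(r, s). r \<noteq> s}. pair_margin cs A r s)"
    unfolding has_margin_def by blast
  then have \<delta>: "\<delta> \<le> pair_margin cs A r s" if "r \<noteq> s" for r s
    using that by (auto intro: INF_lower2[of "(r, s)"])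
  have gap: "f * w r s \<le> \<bar>norm (line_projection (cs r) (cs s) y - cs r)
                          - norm (line_projection (cs r) (cs s) y - cs s)\<bar>"
    if "r \<noteq> s" "y \<in> A r" for r s y
  proof -
    have "ereal (f * w r s) \<le> pair_margin cs A r s"
      using le \<delta> that(1) by (blast intro: order_trans)
    also have "\<dots> \<le> ereal \<bar>norm (line_projection (cs r) (cs s) y - cs r)
                          - norm (line_projection (cs r) (cs s) y - cs s)\<bar>"
      unfolding pair_margin_def using that(2) by (intro INF_lower) auto
    finally show ?thesis by simp
  qed
  note gap = line_projection_gap[OF less_imp_le[OF w] gap]
  obtain t where t: "x \<in> A t"
    using clusterings_owner[OF A clusterings_closest(1)[OF As x]] by metis
  \<comment> \<open>Otherwise \<open>x\<close> would be equidistant from \<open>cs t\<close> and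
    \<open>cs r\<close>, making the right side of the gap zero while its left side is
    positive.\<close>
  have "t = r"
  proof (rule ccontr)
    assume "t \<noteq> r"
    note le = clusterings_closest(2)[OF A t, of r] clusterings_closest(2)[OF As x, of t]
    have "f * w t r \<le> norm (cs t - cs r)"
      and "f * w t r * norm (cs t - cs r) \<le> (norm (x - cs r))\<^sup>2 - (norm (x - cs t))\<^sup>2"
      using gap[OF \<open>t \<noteq> r\<close> t] le by auto
    moreover have "(norm (x - cs r))\<^sup>2 - (norm (x - cs t))\<^sup>2 = 0"
      using le by simp
    ultimately show False
      using w[of t r] mult_pos_pos[OF w[of t r], of "norm (cs t - cs r)"] by linarith
  qed
  then show "f * w r s \<le> norm (cs r - cs s)"
    and "f * w r s * norm (cs r - cs s) \<le> (norm (x - cs s))\<^sup>2 - (norm (x - cs r))\<^sup>2"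
    using gap[OF \<open>r \<noteq> s\<close>, of x] t clusterings_closest(2)[OF As x, of s] by auto
qed

text \<open>The bisector estimate is applied with \<open>d = f * w\<close>. Both cases of
  \<open>r\<close> are needed, since a misassigned point enters the symmetric difference of the
  cluster it leaves and of the one it joins.\<close>

lemma misassigned_point_cost:
  fixes X :: "'a::euclidean_space set" and c cs :: "'k::finite \<Rightarrow> 'a"
  defines "\<phi> \<equiv> kmeans_cost X cs"
  assumes "finite X" and "\<phi> > 0" and "f > 0" and cl: "clusterable X cs As f \<alpha>"
    and "0 \<le> b" and b: "b \<le> f\<^sup>2 / 16\<^sup>2"
    and mc: "matching_cost As c cs \<pi> \<le> b * \<phi>"
    and x: "x \<in> As t" and "t \<noteq> u" and mis: "norm (x - c (\<pi> u)) \<le> norm (x - c (\<pi> t))"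
    and r: "r = t \<or> r = u"
  shows "9 / 64 * f ^ 4 * \<phi> / card (As r) \<le> b * (norm (x - cs t))\<^sup>2"
proof -
  have As: "As \<in> clusterings X cs" and ne: "\<And>r. As r \<noteq> {}"
    using cl by (auto simp: clusterable_def stationary_point_def)
  have "finite (As r)" for r
    using clusterings_closest(1)[OF As(1)] assms(2) by (meson finite_subset subsetI)
  then have n: "card (As r) > 0" for r
    using ne by (simp add: card_gt_0_iff)
  define w where "w = sqrt \<phi> * (1 / sqrt (real (card (As t))) + 1 / sqrt (real (card (As u))))"
  have w: "w > 0"
    unfolding w_def using n assms(3) by (intro mult_pos_pos add_pos_pos) auto
  have wr: "sqrt \<phi> * (1 / sqrt (real (card (As r)))) \<le> w"
    unfolding w_def using r assms(3) by (intro mult_left_mono) auto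
  define e where "e = norm (c (\<pi> t) - cs t) + norm (c (\<pi> u) - cs u)"
  \<comment> \<open>One summand of the matching cost is at most the whole, hence at most
    \<open>b * \<phi>\<close>.\<close>
  have disp: "norm (c (\<pi> s) - cs s) \<le> sqrt b * (sqrt \<phi> * (1 / sqrt (real (card (As s)))))" for s
  proof -
    have "card (As s) * (norm (c (\<pi> s) - cs s))\<^sup>2 \<le> matching_cost As c cs \<pi>"
      unfolding matching_cost_def by (rule member_le_sum) auto
    then have "(norm (c (\<pi> s) - cs s))\<^sup>2 \<le> b * (\<phi> * (1 / card (As s)))"
      using mc n[of s] by (simp add: field_simps)
    then have "norm (c (\<pi> s) - cs s) \<le> sqrt (b * (\<phi> * (1 / card (As s))))"
      by (rule real_le_rsqrt)
    then show ?thesis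
      unfolding real_sqrt_mult real_sqrt_divide real_sqrt_one .
  qed
  have e: "e \<le> sqrt b * w"
    using disp[of t] disp[of u] by (simp add: e_def w_def algebra_simps)
  \<comment> \<open>The bound on \<open>b\<close> is what makes the total displacement at most
    \<open>d / 16\<close>.\<close>
  have "sqrt b \<le> f / 16"
    using b assms(4) by (intro real_le_lsqrt) (auto simp: power_divide)
  then have "sqrt b * w \<le> f / 16 * w"
    using w by (intro mult_right_mono) auto
  then have "e \<le> f * w / 16"
    using e by simp
  then have "3 / 4 * (f * w)\<^sup>2 \<le> 2 * norm (x - cs t) * e"
    unfolding e_def
    using clusterable_gap[OF assms(2) _ assms(4) cl x \<open>t \<noteq> u\<close>] assms(3,4) w mis
    by (intro misassigned_point_far) (auto simp: w_def \<phi>_def)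
  also have "\<dots> \<le> 2 * norm (x - cs t) * (sqrt b * w)"
    using e by (intro mult_left_mono) auto
  \<comment> \<open>One factor \<open>w\<close> cancels. The other is bounded below by its summand
    for \<open>r\<close>, and squaring 3/8 gives the constant 9/64.\<close>
  finally have "(3 / 8 * f\<^sup>2 * w) * w \<le> (norm (x - cs t) * sqrt b) * w"
    by (simp add: power2_eq_square algebra_simps)
  then have "3 / 8 * f\<^sup>2 * w \<le> norm (x - cs t) * sqrt b"
    using w by (rule mult_right_le_imp_le)
  moreover have "3 / 8 * f\<^sup>2 * (sqrt \<phi> * (1 / sqrt (real (card (As r))))) \<le> 3 / 8 * f\<^sup>2 * w"
    using wr by (intro mult_left_mono) auto
  ultimately have "3 / 8 * f\<^sup>2 * (sqrt \<phi> * (1 / sqrt (real (card (As r)))))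
                 \<le> norm (x - cs t) * sqrt b"
    by linarith
  then have "(3 / 8 * f\<^sup>2 * (sqrt \<phi> * (1 / sqrt (real (card (As r))))))\<^sup>2
                 \<le> (norm (x - cs t) * sqrt b)\<^sup>2"
    using assms(3) by (intro power_mono) auto
  then show ?thesis
    using assms(3,6) by (simp add: power_mult_distrib power_divide mult.commute flip: power_mult)
qed

text \<open>A counting argument: each point of the symmetric difference has cost at least
  \<open>l / b\<close> when \<open>b > 0\<close>, and all point costs together amount to
  \<open>\<phi>\<close>.\<close>

lemma clustering_difference_bound:
  fixes X :: "'a::euclidean_space set" and c cs :: "'k::finite \<Rightarrow> 'a"
  defines "\<phi> \<equiv> kmeans_cost X cs"
  assumes "finite X" and "\<phi> > 0" and "f > 64\<^sup>2" and cl: "clusterable X cs As f \<alpha>"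
    and b: "b \<le> f\<^sup>2 / 16\<^sup>2" and cd: "centroid_dist As c cs \<le> b * \<phi>"
    and A: "A \<in> clusterings X c" and \<pi>: "optimal_matching As c cs \<pi>"
  shows "0 \<le> b" and "clust_dist \<pi> A As \<le> b / f ^ 3"
proof -
  have As: "As \<in> clusterings X cs"
    using cl by (auto simp: clusterable_def stationary_point_def)
  have mc: "matching_cost As c cs \<pi> \<le> b * \<phi>" and perm: "\<pi> permutes UNIV"
    using \<pi> cd by (auto simp: optimal_matching_def)
  have "0 \<le> matching_cost As c cs \<pi>"
    unfolding matching_cost_def by (intro sum_nonneg) auto
  then have "0 \<le> b * \<phi>"
    using mc by linarith
  then show "0 \<le> b"
    using assms(3) by (simp add: zero_le_mult_iff)
  have f: "f > 0" "f \<ge> 64 / 9"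
    using assms(4) by auto
  have "real (card (sym_diff (A (\<pi> r)) (As r))) / real (card (As r)) \<le> b / f ^ 3" for r
  proof -
    define D where "D = sym_diff (A (\<pi> r)) (As r)"
    define l where "l = 9 / 64 * f ^ 4 * \<phi> / card (As r)"
    have D: "D \<subseteq> X"
      using clusterings_closest(1)[OF A] clusterings_closest(1)[OF As] by (auto simp: D_def)
    have far: "l \<le> b * (MIN s. (norm (x - cs s))\<^sup>2)" if "x \<in> D" for x
    proof -
      have "x \<in> X" using D that by blast
      obtain t where t: "\<And>s. x \<in> As s \<longleftrightarrow> s = t"
        using clusterings_owner[OF As \<open>x \<in> X\<close>] by blast
      obtain v where v: "\<And>s. x \<in> A s \<longleftrightarrow> s = v"
        using clusterings_owner[OF A \<open>x \<in> X\<close>] by blast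
      obtain u where u: "v = \<pi> u"
        using permutes_surj[OF perm] by (metis surjD)
      have "\<pi> r = \<pi> u \<longleftrightarrow> r = u"
        using permutes_inj[OF perm] by (auto dest: injD)
      \<comment> \<open>Here \<open>t\<close> is the cluster of \<open>x\<close> under
        \<open>As\<close>, and \<open>u\<close> its cluster under \<open>A\<close> after relabelling
        by \<open>\<pi>\<close>. Lying in the symmetric difference at \<open>r\<close> means that
        exactly one of them is \<open>r\<close>.\<close>
      then have tu: "t \<noteq> u" "r = t \<or> r = u"
        using that t v u by (auto simp: D_def)
      have "norm (x - c (\<pi> u)) \<le> norm (x - c (\<pi> t))"
        using clusterings_closest(2)[OF A] v u by blast
      with misassigned_point_cost[OF assms(2) _ f(1) cl \<open>0 \<le> b\<close> b _ _ tu(1) _ tu(2)]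
      have "l \<le> b * (norm (x - cs t))\<^sup>2"
        using mc t assms(3) by (auto simp: l_def \<phi>_def)
      also have "(norm (x - cs t))\<^sup>2 = (MIN s. (norm (x - cs s))\<^sup>2)"
        using kmeans_point_cost[OF As] t by simp
      finally show ?thesis .
    qed
    have nonneg: "0 \<le> (MIN s. (norm (x - cs s))\<^sup>2)" for x
      by (intro Min.boundedI) auto
    have "card D * l \<le> (\<Sum>x\<in>D. b * (MIN s. (norm (x - cs s))\<^sup>2))"
      using far by (intro sum_bounded_below) auto
    also have "\<dots> \<le> (\<Sum>x\<in>X. b * (MIN s. (norm (x - cs s))\<^sup>2))"
      using assms(2) D \<open>0 \<le> b\<close> nonneg by (intro sum_mono2) auto
    also have "\<dots> = b * \<phi>"
      by (simp add: \<phi>_def kmeans_cost_def sum_distrib_left)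
    finally have "card D / card (As r) * (9 / 64 * f ^ 4) * \<phi> \<le> b * \<phi>"
      by (simp add: l_def mult_ac)
    then have "card D / card (As r) * (9 / 64 * f ^ 4) \<le> b"
      using assms(3) by (rule mult_right_le_imp_le)
    \<comment> \<open>One of the four factors \<open>f\<close> is spent on absorbing the constant
      9/64.\<close>
    moreover have "f ^ 3 \<le> 9 / 64 * f ^ 4"
      using f mult_right_mono[of "64 / 9" f "f ^ 3"] by (simp add: eval_nat_numeral)
    then have "card D / card (As r) * f ^ 3 \<le> card D / card (As r) * (9 / 64 * f ^ 4)"
      by (intro mult_left_mono) auto
    ultimately show ?thesis
      using f by (simp add: pos_le_divide_eq D_def)
  qed
  then show "clust_dist \<pi> A As \<le> b / f ^ 3"
    unfolding clust_dist_def by (intro Max.boundedI) auto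
qed

section \<open>From the difference bound to stability\<close>

lemma clusterable_parameter:
  fixes cs :: "'k::finite \<Rightarrow> 'a::euclidean_space"
  assumes "clusterable X cs As f \<alpha>"
  shows "f > 64\<^sup>2" and "f > (5 * \<alpha> + 5) / (256 * \<alpha>)"
proof -
  have "finite {real (card (As r)) / real (card (As s)) | r s. r \<noteq> s}"
    by (rule finite_subset[of _ "range (\<lambda>(r, s). real (card (As r)) / real (card (As s)))"]) auto
  then show "f > 64\<^sup>2" and "f > (5 * \<alpha> + 5) / (256 * \<alpha>)"
    using assms by (auto simp: clusterable_def)
qed

text \<open>The witness is the largest one allowed, \<open>\<alpha> * b'\<close>. It then suffices
  that the denominator in the definition of stability is at most \<open>\<alpha> * f ^ 3\<close>,
  because the cluster distance is at most \<open>b' / f ^ 3\<close>.\<close>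

lemma clusterable_imp_stable:
  fixes cs :: "'k::finite \<Rightarrow> 'a::euclidean_space"
  assumes "finite X" and \<phi>: "kmeans_cost X cs > 0" and \<alpha>: "0 < \<alpha>" "\<alpha> < 1"
    and cl: "clusterable X cs As f \<alpha>"
  shows "is_stable X cs As (f\<^sup>2 / 16\<^sup>2) \<alpha>"
proof -
  note f = clusterable_parameter[OF cl]
  have st: "stationary_point X cs As"
    using cl by (simp add: clusterable_def)
  have "\<exists>b. 0 \<le> b \<and> b \<le> \<alpha> * b' \<and>
           (\<forall>A \<in> clusterings X c. \<forall>\<pi>. optimal_matching As c cs \<pi> \<longrightarrow>
              clust_dist \<pi> A As \<le>
                b / (5 * b + 4 * (1 + kmeans_cost X c / kmeans_cost X cs)))"
    if b': "b' \<le> f\<^sup>2 / 16\<^sup>2" and cd: "centroid_dist As c cs \<le> b' * kmeans_cost X cs" for b' c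
  proof -
    \<comment> \<open>An optimal matching exists, as a minimum over a finite set containing the
      identity. It yields both \<open>0 \<le> b'\<close> and the bound on the cost of
      \<open>c\<close>.\<close>
    have "centroid_dist As c cs \<in> matching_cost As c cs ` {\<pi>. \<pi> permutes UNIV}"
      unfolding centroid_dist_def by (intro Min_in) (auto intro: permutes_id)
    then obtain \<pi>\<^sub>0 where mc: "matching_cost As c cs \<pi>\<^sub>0 = centroid_dist As c cs"
      by auto
    have "0 \<le> matching_cost As c cs \<pi>\<^sub>0"
      unfolding matching_cost_def by (intro sum_nonneg) auto
    then have "0 \<le> b' * kmeans_cost X cs"
      using mc cd by linarith
    then have "0 \<le> b'"
      using \<phi> by (simp add: zero_le_mult_iff)
    define q where "q = kmeans_cost X c / kmeans_cost X cs"
    have "kmeans_cost X c \<le> (1 + b') * kmeans_cost X cs"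
      using kmeans_cost_matching[OF assms(1) st, of c \<pi>\<^sub>0] mc cd by (simp add: algebra_simps)
    then have "q \<le> 1 + b'"
      using \<phi> by (simp add: q_def pos_divide_le_eq)
    have "0 \<le> kmeans_cost X c"
      unfolding kmeans_cost_def by (intro sum_nonneg Min.boundedI) auto
    then have "0 \<le> q"
      using \<phi> by (simp add: q_def)
    have pos: "0 < 5 * (\<alpha> * b') + 4 * (1 + q)"
      using \<alpha> \<open>0 \<le> b'\<close> \<open>0 \<le> q\<close> by (intro add_nonneg_pos) auto
    \<comment> \<open>This trades the constant 8 for one more multiple of
      \<open>f\<^sup>2 / 256\<close>, turning \<open>5 * \<alpha> + 4\<close> into
      \<open>5 * \<alpha> + 5\<close>.\<close>
    have "8 \<le> f\<^sup>2 / 256"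
      using f(1) power_mono[of "64\<^sup>2" f 2] by simp
    have "5 * (\<alpha> * b') + 4 * (1 + q) \<le> (5 * \<alpha> + 4) * b' + 8"
      using \<open>q \<le> 1 + b'\<close> by (simp add: algebra_simps)
    also have "\<dots> \<le> (5 * \<alpha> + 4) * (f\<^sup>2 / 256) + f\<^sup>2 / 256"
      using b' \<alpha> \<open>8 \<le> f\<^sup>2 / 256\<close> by (intro add_mono mult_left_mono) auto
    also have "\<dots> = (5 * \<alpha> + 5) / 256 * f\<^sup>2"
      by (simp add: algebra_simps)
    \<comment> \<open>The second lower bound on \<open>f\<close> in clusterability is tailored to
      this comparison.\<close>
    also have "\<dots> \<le> (\<alpha> * f) * f\<^sup>2"
      using f(2) \<alpha> by (intro mult_right_mono) (auto simp: field_simps)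
    also have "\<dots> = \<alpha> * f ^ 3"
      by (simp add: eval_nat_numeral)
    finally have le: "5 * (\<alpha> * b') + 4 * (1 + q) \<le> \<alpha> * f ^ 3" .
    have f0: "f > 0"
      using f(1) by simp
    have "b' * (5 * (\<alpha> * b') + 4 * (1 + q)) \<le> b' * (\<alpha> * f ^ 3)"
      using le \<open>0 \<le> b'\<close> by (intro mult_left_mono) auto
    then have "b' / f ^ 3 \<le> \<alpha> * b' / (5 * (\<alpha> * b') + 4 * (1 + q))"
      using pos f0 by (simp add: pos_divide_le_eq pos_le_divide_eq mult_ac)
    then have "clust_dist \<pi> A As \<le> \<alpha> * b' / (5 * (\<alpha> * b') + 4 * (1 + q))"
      if "A \<in> clusterings X c" "optimal_matching As c cs \<pi>" for A \<pi>
      using clustering_difference_bound(2)[OF assms(1) \<phi> f(1) cl b' cd that] by linarith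
    then show ?thesis
      using \<alpha> \<open>0 \<le> b'\<close> by (intro exI[of _ "\<alpha> * b'"]) (auto simp: q_def)
  qed
  then show ?thesis
    using f(1) \<alpha> st by (simp add: is_stable_def)
qed

theorem proposition1:
  fixes X :: "(real ^ 'd) set"
    and cs :: "'k::finite \<Rightarrow> real ^ 'd"
    and As :: "'k \<Rightarrow> (real ^ 'd) set"
    and f :: "real \<Rightarrow> real"
    and \<alpha> :: real
  assumes "finite X"
    and "kmeans_cost X cs > 0"
    and "0 < \<alpha>" and "\<alpha> < 1"
    and "clusterable X cs As (f \<alpha>) \<alpha>"
  shows "(\<forall>c b. b \<le> (f \<alpha>)\<^sup>2 / 16\<^sup>2 \<longrightarrow> centroid_dist As c cs \<le> b * kmeans_cost X cs \<longrightarrow>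
            (\<forall>A \<in> clusterings X c. \<forall>\<pi>. optimal_matching As c cs \<pi> \<longrightarrow>
               (MAX r. real (card (sym_diff (A (\<pi> r)) (As r))) / real (card (As r)))
                 \<le> b / (f \<alpha>) ^ 3)) \<and>
         is_stable X cs As ((f \<alpha>)\<^sup>2 / 16\<^sup>2) \<alpha>"
  using clustering_difference_bound(2)[OF assms(1,2) clusterable_parameter(1)[OF assms(5)] assms(5)]
    clusterable_imp_stable[OF assms]
  unfolding clust_dist_def by blast

end
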